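(* Let $\zeta_{\mathbb{Z}}$ be the spectral zeta function of $\mathbb{Z}$. For every $s\in\mathbb{C}$ such that $2s$ is not a positive integer, the infinite product below converges and $$\zeta_{\mathbb{Z}}(s)=\prod_{k=1}^{\infty}\frac{(k-s)^{2}}{k(k-2s)}.$$ At the remaining points $s_0\in\{1/2,1,3/2,2,\dots\}$ (where one factor has vanishing denominator) the identity holds in the sense of meromorphic functions, that is, the right-hand side is interpreted as the limit of the product as $s\to s_0$, with value in $\mathbb{C}\cup\{\infty\}$.
   Context: The spectral zeta function of $\mathbb{Z}$ is defined by $$\zeta_{\mathbb{Z}}(s)=\frac{1}{\Gamma(s)}\int_{0}^{\infty}e^{-2t}I_{0}(2t)\,t^{s}\,\frac{dt}{t}\qquad\text{for }0<\mathrm{Re}(s)<1/2,$$ where $I_0$ is the modified Bessel function of the first kind of order $0$, and is extended to $\mathbb{C}$ by meromorphic continuation. It is known (from earlier work) that this meromorphic continuation is given by $$\zeta_{\mathbb{Z}}(s)=\frac{1}{4^{s}\sqrt{\pi}}\frac{\Gamma(1/2-s)}{\Gamma(1-s)}=\frac{\Gamma(1-2s)}{\Gamma(1-s)^2}.$$ *)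

theory Defs
  imports "HOL-Complex_Analysis.Complex_Analysis"
begin

text \<open>Modified Bessel function of the first kind of order 0.\<close>

definition bessel_I0 :: "real \<Rightarrow> real" where
  "bessel_I0 x = (\<Sum>k. (x / 2) ^ (2 * k) / (fact k)\<^sup>2)"

definition spectral_zeta_Z_integral :: "complex \<Rightarrow> complex" where
  "spectral_zeta_Z_integral s =
     1 / Gamma s *
     (LBINT t:{0<..}. of_real (exp (- 2 * t) * bessel_I0 (2 * t)) *
                       complex_of_real t powr s / complex_of_real t)"

text \<open>
  The meromorphic continuation to the whole plane. Among all functions representing it,
  \<^const>\<open>nicely_meromorphic_on\<close> selects the one without removable singularities
  (and with value 0 at the poles), which makes it unique as a function. That the value at a pole
  is a mere convention has to be kept in mind; use \<^const>\<open>is_pole\<close> to detect the value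
  \<open>\<infinity>\<close>.
\<close>

definition spectral_zeta_Z :: "complex \<Rightarrow> complex" where
  "spectral_zeta_Z = (THE f. f nicely_meromorphic_on UNIV \<and>
     (\<forall>s. 0 < Re s \<and> Re s < 1 / 2 \<longrightarrow> f s = spectral_zeta_Z_integral s))"

text \<open>
  The library indexes infinite products from 0, so the factor for \<open>k = 1, 2, \<dots>\<close> sits at
  position \<open>k - 1\<close>.
\<close>

definition zeta_Z_factor :: "complex \<Rightarrow> nat \<Rightarrow> complex" where
  "zeta_Z_factor s k = (of_nat k - s)\<^sup>2 / (of_nat k * (of_nat k - 2 * s))"

end

theory Submission
  imports Defs
begin

text \<open>
  The function \<open>exp (-2 t) I\<^sub>0 (2 t)\<close> is the Laplace transform, at \<open>4 t\<close>, of the arcsine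
  distribution on the unit interval: after removing the factor \<open>exp (-2 t)\<close>, the power series
  agree because the \<open>2 k\<close>-th moment of \<open>1 - 2 u\<close> is \<open>(2 k choose k) / 4\<^sup>k\<close> and the odd
  moments vanish. Fubini then turns the Mellin transform into a complex Beta integral, which gives
  \<open>4\<^sup>-\<^sup>s \<Gamma>(1/2 - s) / (sqrt \<pi> \<Gamma>(1 - s))\<close> on the strip. By Legendre duplication this is
  \<open>\<Gamma>(1 - 2 s) / \<Gamma>(1 - s)\<^sup>2\<close>, and the partial products are exactly the
  corresponding quotients of Gauss's approximants of \<open>1 / \<Gamma>\<close>, the exponential factors
  cancelling.
\<close>

section \<open>Complex powers on the half-line and Gamma integrals\<close>

text \<open>Extension by 0 lets half-line and unit-interval integrals be written over all of
  \<open>lborel\<close>, so substitutions and Fubini need no domain bookkeeping.\<close>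

definition pos_powr :: "complex \<Rightarrow> real \<Rightarrow> complex" where
  "pos_powr z t = (if t > 0 then complex_of_real t powr z else 0)"

lemma pos_powr_conv_exp: "pos_powr z t = (if t > 0 then exp (z * of_real (ln t)) else 0)"
  by (auto simp: pos_powr_def powr_def Ln_of_real)

lemma borel_measurable_pos_powr [measurable]:
  assumes [measurable]: "f \<in> borel_measurable M"
  shows "(\<lambda>x. pos_powr z (f x)) \<in> borel_measurable M"
  unfolding pos_powr_conv_exp by measurable

lemma of_real_norm_pos_powr: "complex_of_real (norm (pos_powr z t)) = pos_powr (of_real (Re z)) t"
  by (auto simp: pos_powr_conv_exp norm_exp_eq_Re simp flip: exp_of_real)

lemma norm_pos_powr: "norm (pos_powr z t) = (if t > 0 then t powr Re z else 0)"
  by (auto simp: pos_powr_def norm_powr_real_powr)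

lemma pos_powr_mult: "c > 0 \<Longrightarrow> pos_powr z (c * t) = pos_powr z c * pos_powr z t"
  by (auto simp: pos_powr_conv_exp ln_mult exp_add ring_distribs zero_less_mult_iff)

lemma pos_powr_add: "pos_powr (a + b) t = pos_powr a t * pos_powr b t"
  by (auto simp: pos_powr_conv_exp exp_add ring_distribs)

lemma pos_powr_1: "t > 0 \<Longrightarrow> pos_powr 1 t = of_real t"
  by (auto simp: pos_powr_def)

text \<open>Euler's integral carried over from the gauge integral: absolute integrability yields the
  Bochner integral, and uniqueness of the gauge integral its value.\<close>

lemma has_bochner_integral_Gamma:
  assumes "Re z > 0"
  shows "has_bochner_integral lborel (\<lambda>t. pos_powr (z - 1) t * of_real (exp (- t))) (Gamma z)"
proof -
  have eq: "(\<lambda>t. pos_powr (z - 1) t * of_real (exp (- t))) =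
        (\<lambda>t. indicator {0<..} t *\<^sub>R (complex_of_real t powr (z - 1) / of_real (exp t)))"
    by (auto simp: pos_powr_def exp_minus divide_inverse)
  have "integrable lebesgue (\<lambda>t. pos_powr (z - 1) t * of_real (exp (- t)))"
    using absolutely_integrable_Gamma_integral'[OF assms] unfolding eq set_integrable_def .
  hence int: "integrable lborel (\<lambda>t. pos_powr (z - 1) t * of_real (exp (- t)))"
    by (subst (asm) integrable_completion) auto
  have "((\<lambda>t. pos_powr (z - 1) t * of_real (exp (- t))) has_integral Gamma z) UNIV"
  proof -
    have "(\<lambda>t. pos_powr (z - 1) t * of_real (exp (- t))) =
          (\<lambda>t. if t \<in> {0<..} then complex_of_real t powr (z - 1) / of_real (exp t) else 0)"
      by (auto simp: pos_powr_def exp_minus divide_inverse)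
    thus ?thesis
      using Gamma_integral_complex'[OF assms] by (simp only: has_integral_restrict_UNIV)
  qed
  with has_integral_integral_lborel[OF int] int show ?thesis
    by (auto simp: has_bochner_integral_iff dest: has_integral_unique)
qed

lemma has_bochner_integral_Gamma_scaled:
  assumes "Re z > 0" "c > 0"
  shows "has_bochner_integral lborel (\<lambda>t. pos_powr (z - 1) t * of_real (exp (- (c * t))))
           (Gamma z * pos_powr (- z) c)"
proof -
  have "pos_powr (- z) c * pos_powr z c = 1"
    using assms by (simp add: pos_powr_conv_exp flip: exp_add)
  hence inv: "pos_powr (- z) c * (of_real c * pos_powr (z - 1) c) = 1"
    using pos_powr_add[of "z - 1" 1 c] assms by (simp add: pos_powr_1 mult_ac)
  have "has_bochner_integral lborel
          (\<lambda>t. pos_powr (z - 1) (0 + c * t) * of_real (exp (- (0 + c * t)))) (Gamma z /\<^sub>R c)"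
    using lborel_has_bochner_integral_real_affine_iff[of c _ "Gamma z" 0]
          has_bochner_integral_Gamma[OF assms(1)] assms by simp
  from has_bochner_integral_mult_right[OF this, of "of_real c * pos_powr (- z) c"]
  show ?thesis
  proof (rule has_bochner_integral_cong[THEN iffD1, rotated -1])
    fix t
    show "of_real c * pos_powr (- z) c * (pos_powr (z - 1) (0 + c * t) * of_real (exp (- (0 + c * t))))
            = pos_powr (z - 1) t * of_real (exp (- (c * t)))"
      using inv assms by (simp add: pos_powr_mult algebra_simps)
  qed (use assms in \<open>auto simp: scaleR_conv_of_real field_simps\<close>)
qed

text \<open>The norm of a Gamma integrand is the Gamma integrand with exponent \<open>Re z\<close>.
  This supplies the absolute integrability that Fubini requires.\<close>

lemma has_bochner_integral_norm_Gamma_scaled: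
  assumes "Re z > 0" "c > 0"
  shows "has_bochner_integral lborel (\<lambda>t. norm (pos_powr (z - 1) t * of_real (exp (- (c * t)))))
           (Gamma (Re z) * norm (pos_powr (- z) c))"
proof -
  have "has_bochner_integral lborel
      (\<lambda>t. Re (pos_powr (of_real (Re z) - 1) t * of_real (exp (- (c * t)))))
      (Re (Gamma (of_real (Re z)) * pos_powr (- of_real (Re z)) c))"
    by (intro has_bochner_integral_bounded_linear[OF bounded_linear_Re]
          has_bochner_integral_Gamma_scaled) (use assms in auto)
  also have "(\<lambda>t. Re (pos_powr (of_real (Re z) - 1) t * of_real (exp (- (c * t))))) =
      (\<lambda>t. norm (pos_powr (z - 1) t * of_real (exp (- (c * t)))))"
  proof
    fix t
    have "pos_powr (of_real (Re z) - 1) t = of_real (norm (pos_powr (z - 1) t))"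
      by (simp add: of_real_norm_pos_powr)
    thus "Re (pos_powr (of_real (Re z) - 1) t * of_real (exp (- (c * t)))) =
          norm (pos_powr (z - 1) t * of_real (exp (- (c * t))))"
      by (simp add: norm_mult)
  qed
  also have "pos_powr (- of_real (Re z)) c = of_real (norm (pos_powr (- z) c))"
    by (simp add: of_real_norm_pos_powr)
  finally show ?thesis by (simp add: Gamma_complex_of_real)
qed

section \<open>The Beta integral with complex parameters\<close>

lemma integrable_Beta_complex:
  assumes "Re a > 0" "Re b > 0"
  shows "integrable lborel (\<lambda>u. pos_powr (a - 1) u * pos_powr (b - 1) (1 - u))"
proof (rule Bochner_Integration.integrable_bound)
  show "integrable lborel (\<lambda>u. indicator {0..1} u *\<^sub>R (u powr (Re a - 1) * (1 - u) powr (Re b - 1)))"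
    using integrable_Beta[OF assms] unfolding set_integrable_def .
qed (auto simp: norm_mult norm_pos_powr)

lemma nonpos_Ints_imp_Re_nonpos: "z \<in> \<int>\<^sub>\<le>\<^sub>0 \<Longrightarrow> Re z \<le> 0"
  by (auto elim!: nonpos_Ints_cases)

text \<open>The classical argument: \<open>Gamma a * Gamma b\<close> is a double integral; taking
  the sum of the two variables as a new variable splits it into \<open>Gamma (a + b)\<close> times
  the Beta integral.\<close>

lemma has_bochner_integral_Beta_complex:
  assumes a: "Re a > 0" and b: "Re b > 0"
  shows "has_bochner_integral lborel (\<lambda>u. pos_powr (a - 1) u * pos_powr (b - 1) (1 - u)) (Beta a b)"
proof -
  define B where "B = (LINT u|lborel. pos_powr (a - 1) u * pos_powr (b - 1) (1 - u))"
  \<comment> \<open>Here \<open>w\<close> is the sum of the two Gamma variables. The zero convention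
    of \<open>pos_powr\<close> confines the support to \<open>0 < t < w\<close>.\<close>
  define f where "f = (\<lambda>t w. pos_powr (a - 1) t * (pos_powr (b - 1) (w - t) * complex_of_real (exp (- w))))"
  define C where "C = (LINT w|lborel. norm (pos_powr (b - 1) w * complex_of_real (exp (- w))))"
  have [measurable]: "case_prod f \<in> borel_measurable (lborel \<Otimes>\<^sub>M lborel)"
    unfolding f_def by measurable
  have shift: "f t (t + 1 * w) = pos_powr (a - 1) t * of_real (exp (- t)) *
                  (pos_powr (b - 1) w * complex_of_real (exp (- w)))" for t w
  proof -
    have "exp (- (t + w)) = exp (- t) * exp (- w)"
      by (simp flip: exp_add)
    thus ?thesis
      by (simp add: f_def mult_ac)
  qed
  have int1: "integrable lborel (\<lambda>w. f t w)" for t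
  proof (subst lborel_integrable_real_affine_iff[of 1 _ t, symmetric])
    show "integrable lborel (\<lambda>w. f t (t + 1 * w))" unfolding shift
      by (intro integrable_mult_right has_bochner_integral_Gamma[OF b, THEN integrable.intros])
  qed auto
  have "integrable lborel (\<lambda>t. LINT w|lborel. norm (f t w))"
  proof -
    have "(LINT w|lborel. norm (f t w)) = norm (pos_powr (a - 1) t * of_real (exp (- t))) * C" for t
      by (subst lborel_integral_real_affine[of 1 _ t]) (simp_all only: shift, simp_all add: norm_mult C_def)
    thus ?thesis
      using has_bochner_integral_Gamma[OF a, THEN integrable.intros] by simp
  qed
  hence "integrable (lborel \<Otimes>\<^sub>M lborel) (case_prod f)"
    by (intro lborel_pair.Fubini_integrable) (use int1 in auto)
  hence "(LINT w|lborel. LINT t|lborel. f t w) = (LINT t|lborel. LINT w|lborel. f t w)"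
    by (rule lborel_pair.Fubini_integral)
  also have "(LINT w|lborel. f t w) = pos_powr (a - 1) t * of_real (exp (- t)) * Gamma b" for t
    using has_bochner_integral_Gamma[OF b]
    by (subst lborel_integral_real_affine[of 1 _ t])
       (simp_all only: shift, simp_all add: has_bochner_integral_iff)
  hence "(LINT t|lborel. LINT w|lborel. f t w) =
           (LINT t|lborel. pos_powr (a - 1) t * of_real (exp (- t)) * Gamma b)"
    by simp
  also have "\<dots> = Gamma a * Gamma b"
    using has_bochner_integral_Gamma[OF a] by (simp add: has_bochner_integral_iff)
  also have "(LINT w|lborel. LINT t|lborel. f t w) =
             (LINT w|lborel. pos_powr (a + b - 1) w * of_real (exp (- w)) * B)"
  proof (intro Bochner_Integration.integral_cong refl)
    fix w :: real
    show "(LINT t|lborel. f t w) = pos_powr (a + b - 1) w * of_real (exp (- w)) * B"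
    proof (cases "w > 0")
      case False
      hence "f t w = 0" for t
        by (auto simp: f_def pos_powr_def)
      thus ?thesis using False by (simp add: pos_powr_def)
    next
      case True
      \<comment> \<open>Substituting \<open>t = w * u\<close> pulls all powers of \<open>w\<close>
        out of the inner integral; the Jacobian contributes the missing factor
        \<open>w\<close>.\<close>
      have "f (0 + w * u) w = pos_powr (a - 1) w * pos_powr (b - 1) w * of_real (exp (- w)) *
               (pos_powr (a - 1) u * pos_powr (b - 1) (1 - u))" for u
        using pos_powr_mult[OF True, of "b - 1" "1 - u"] pos_powr_mult[OF True, of "a - 1" u]
        by (simp add: f_def algebra_simps)
      hence "(LINT t|lborel. f t w) =
               of_real w * (pos_powr (a - 1) w * pos_powr (b - 1) w * of_real (exp (- w)) * B)"
        using True by (subst lborel_integral_real_affine[of w _ 0]) (auto simp: B_def scaleR_conv_of_real)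
      moreover have "pos_powr (a + b - 1) w = pos_powr (a - 1) w * pos_powr (b - 1) w * of_real w"
        using True pos_powr_add[of "a - 1 + (b - 1)" 1 w] pos_powr_add[of "a - 1" "b - 1" w]
        by (simp add: pos_powr_1 algebra_simps)
      ultimately show ?thesis by (simp add: mult_ac)
    qed
  qed
  also have "\<dots> = Gamma (a + b) * B"
    using has_bochner_integral_Gamma[of "a + b"] a b by (simp add: has_bochner_integral_iff)
  finally have "Gamma (a + b) * B = Gamma a * Gamma b" .
  moreover have "Gamma (a + b) \<noteq> 0"
    using a b nonpos_Ints_imp_Re_nonpos[of "a + b"] by (auto simp: Gamma_eq_zero_iff)
  ultimately have "B = Beta a b"
    by (simp add: Beta_def field_simps)
  with integrable_Beta_complex[OF a b] show ?thesis
    by (simp add: has_bochner_integral_iff B_def)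
qed

section \<open>The arcsine distribution and its moments\<close>

text \<open>Not normalised: the total mass is \<open>\<pi>\<close>.\<close>

definition arcsine_density :: "real \<Rightarrow> real" where
  "arcsine_density u = (if 0 < u \<and> u < 1 then 1 / sqrt (u * (1 - u)) else 0)"

text \<open>The exponents stay in the form \<open>1/2 - 1\<close> so that the right-hand side
  matches the Beta integrand with both parameters 1/2.\<close>

lemma of_real_arcsine_density:
  "complex_of_real (arcsine_density u) = pos_powr (1/2 - 1) u * pos_powr (1/2 - 1) (1 - u)"
proof (cases "0 < u \<and> u < 1")
  case True
  have *: "pos_powr (1/2 - 1) x = of_real (1 / sqrt x)" if "x > 0" for x :: real
  proof -
    have "pos_powr (1/2 - 1) x = of_real x powr (of_real (-(1/2)))"
      using that by (simp add: pos_powr_def)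
    also have "\<dots> = of_real (x powr (-(1/2)))"
      using that by (subst powr_of_real) auto
    finally show ?thesis
      using that powr_minus[of x "1/2"] by (simp add: powr_half_sqrt inverse_eq_divide)
  qed
  show ?thesis
    using True *[of u] *[of "1 - u"] by (simp add: arcsine_density_def real_sqrt_mult)
qed (auto simp: arcsine_density_def pos_powr_def)

lemma borel_measurable_arcsine_density [measurable]: "arcsine_density \<in> borel_measurable borel"
  unfolding arcsine_density_def by measurable

lemma arcsine_density_nonneg [simp]: "arcsine_density u \<ge> 0"
  by (simp add: arcsine_density_def)

lemma has_bochner_integral_arcsine_density: "has_bochner_integral lborel arcsine_density pi"
proof -
  have "has_bochner_integral lborel (\<lambda>u. Re (complex_of_real (arcsine_density u))) (Re (Beta (1/2) (1/2)))"
    unfolding of_real_arcsine_density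
    by (intro has_bochner_integral_bounded_linear[OF bounded_linear_Re]
          has_bochner_integral_Beta_complex) auto
  moreover have "Beta (1/2) (1/2) = complex_of_real pi"
    by (simp add: Beta_def Gamma_one_half_complex flip: of_real_mult)
  ultimately show ?thesis by simp
qed

lemma integrable_arcsine_density_mult:
  fixes g :: "real \<Rightarrow> real"
  assumes [measurable]: "g \<in> borel_measurable borel"
  assumes "\<And>u. 0 < u \<Longrightarrow> u < 1 \<Longrightarrow> \<bar>g u\<bar> \<le> C"
  shows "integrable lborel (\<lambda>u. g u * arcsine_density u)"
proof (rule Bochner_Integration.integrable_bound)
  show "integrable lborel (\<lambda>u. C * arcsine_density u)"
    using has_bochner_integral_arcsine_density by (intro integrable_mult_right integrable.intros)
  have "norm (g u * arcsine_density u) \<le> norm (C * arcsine_density u)" for u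
  proof (cases "0 < u \<and> u < 1")
    case True
    hence "\<bar>g u\<bar> \<le> \<bar>C\<bar>"
      using assms(2)[of u] by simp
    thus ?thesis by (simp add: abs_mult mult_right_mono)
  qed (auto simp: arcsine_density_def)
  thus "AE u in lborel. norm (g u * arcsine_density u) \<le> norm (C * arcsine_density u)"
    by simp
qed measurable

text \<open>The variable \<open>1 - 2 * u\<close> moves the support to [-1, 1], where the density is
  symmetric about 0.\<close>

definition arcsine_moment :: "nat \<Rightarrow> real" where
  "arcsine_moment n = (LINT u|lborel. (1 - 2 * u) ^ n * arcsine_density u)"

lemma integrable_arcsine_moment: "integrable lborel (\<lambda>u. (1 - 2 * u) ^ n * arcsine_density u)"
  by (rule integrable_arcsine_density_mult[of _ 1]) (auto simp: power_abs intro!: power_le_one)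

lemma arcsine_moment_0: "arcsine_moment 0 = pi"
  using has_bochner_integral_arcsine_density by (simp add: arcsine_moment_def has_bochner_integral_iff)

text \<open>
  The recursion expresses that \<open>(1 - 2 u)\<^sup>n sqrt (u (1 - u))\<close> vanishes at both end points.
\<close>

lemma arcsine_moment_Suc:
  "real (Suc n) * arcsine_moment (Suc n) = real n * arcsine_moment (n - 1)"
proof -
  define F where "F = (\<lambda>u::real. (1 - 2 * u) ^ n * sqrt (u * (1 - u)))"
  define h where "h = (\<lambda>u::real. (real (Suc n) / 2) * ((1 - 2 * u) ^ Suc n * arcsine_density u) -
                        (real n / 2) * ((1 - 2 * u) ^ (n - 1) * arcsine_density u))"
  have "(h has_integral (F 1 - F 0)) {0..1}"
  \<comment> \<open>The square root is not differentiable at the end points, so only continuity is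
    used there.\<close>
  proof (rule fundamental_theorem_of_calculus_interior)
    show "continuous_on {0..1} F"
      unfolding F_def by (intro continuous_intros)
    fix u :: real assume u: "u \<in> {0<..<1}"
    define r where "r = sqrt (u * (1 - u))"
    have r: "r > 0" "r ^ 2 = u * (1 - u)"
      using u by (auto simp: r_def)
    have "((\<lambda>u::real. (1 - 2 * u) ^ n) has_real_derivative - 2 * real n * (1 - 2 * u) ^ (n - 1)) (at u)"
      by (auto intro!: derivative_eq_intros)
    moreover have "((\<lambda>u. sqrt (u * (1 - u))) has_real_derivative (1 - 2 * u) * (inverse r / 2)) (at u)"
      unfolding r_def using u by (auto intro!: derivative_eq_intros simp: zero_less_mult_iff mult_less_0_iff)
    ultimately have "(F has_real_derivative
             ((1 - 2 * u) ^ n * ((1 - 2 * u) * (inverse r / 2)) - 2 * real n * (1 - 2 * u) ^ (n - 1) * r)) (at u)"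
      unfolding F_def by (rule DERIV_mult'[THEN DERIV_cong]) (simp add: r_def)
    also have "((1 - 2 * u) ^ n * ((1 - 2 * u) * (inverse r / 2)) - 2 * real n * (1 - 2 * u) ^ (n - 1) * r) = h u"
    \<comment> \<open>For \<open>n = 0\<close> the truncated exponent \<open>n - 1\<close> is
      harmless, since its coefficient is 0; otherwise \<open>x ^ n\<close> has to be split as
      \<open>x * x ^ m\<close>.\<close>
    proof (cases n)
      case 0
      have "arcsine_density u = inverse r"
        using u by (simp add: arcsine_density_def r_def inverse_eq_divide)
      with 0 show ?thesis by (simp add: h_def)
    next
      case (Suc m)
      define x where "x = 1 - 2 * u"
      have x: "u * (1 - u) = (1 - x * x) / 4"
        by (simp add: x_def field_simps)
      have d: "arcsine_density u * r = 1"
        using u r(1) by (simp add: arcsine_density_def r_def)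
      \<comment> \<open>Multiplying by \<open>r\<close> clears the reciprocal square roots;
        \<open>r ^ 2 = (1 - x * x) / 4\<close> then makes both sides polynomials in
        \<open>x\<close>.\<close>
      have "h u * r = real (Suc n) / 2 * x ^ Suc n * (arcsine_density u * r) -
                      real n / 2 * x ^ m * (arcsine_density u * r)"
        by (simp add: h_def Suc x_def algebra_simps)
      also have "\<dots> = x ^ Suc n / 2 - 2 * real n * x ^ m * r ^ 2"
        unfolding r(2) d x Suc power_Suc by (simp add: field_simps)
      also have "\<dots> = (x ^ n * (x * (inverse r / 2)) - 2 * real n * x ^ (n - 1) * r) * r"
        using r(1) by (simp add: Suc field_simps power2_eq_square)
      also have "x = 1 - 2 * u"
        by (fact x_def)
      finally show ?thesis using r(1) by simp
    qed
    finally show "(F has_vector_derivative h u) (at u)"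
      by (simp add: has_real_derivative_iff_has_vector_derivative)
  qed auto
  hence "(h has_integral 0) {0..1}"
    by (simp add: F_def)
  hence "((\<lambda>u. if u \<in> {0..1} then h u else 0) has_integral 0) UNIV"
    by (simp only: has_integral_restrict_UNIV)
  also have "(\<lambda>u. if u \<in> {0..1} then h u else 0) = h"
    by (auto simp: h_def arcsine_density_def)
  finally have "(h has_integral 0) UNIV" .
  moreover have "integrable lborel h"
    unfolding h_def by (intro Bochner_Integration.integrable_diff integrable_mult_right integrable_arcsine_moment)
  ultimately have "(LINT u|lborel. h u) = 0"
    using has_integral_integral_lborel has_integral_unique by blast
  also have "(LINT u|lborel. h u) =
      real (Suc n) / 2 * arcsine_moment (Suc n) - real n / 2 * arcsine_moment (n - 1)"
    unfolding h_def arcsine_moment_def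
    by (subst Bochner_Integration.integral_diff) (intro integrable_mult_right integrable_arcsine_moment | simp)+
  finally show ?thesis by simp
qed

text \<open>The recursion steps by two, and at \<open>n = 0\<close> its right-hand side has
  coefficient 0, so the whole odd chain vanishes.\<close>

lemma arcsine_moment_odd: "arcsine_moment (Suc (2 * k)) = 0"
proof (induction k)
  case 0
  show ?case using arcsine_moment_Suc[of 0] by simp
next
  case (Suc k)
  show ?case using arcsine_moment_Suc[of "2 * Suc k"] Suc by simp
qed

lemma arcsine_moment_even: "arcsine_moment (2 * k) = pi * fact (2 * k) / (4 ^ k * (fact k)\<^sup>2)"
proof (induction k)
  case 0
  show ?case by (simp add: arcsine_moment_0)
next
  case (Suc k)
  have "(2 * real k + 2) * arcsine_moment (2 * Suc k) = (2 * real k + 1) * arcsine_moment (2 * k)"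
    using arcsine_moment_Suc[of "Suc (2 * k)"] by (simp add: algebra_simps)
  hence "arcsine_moment (2 * Suc k) = (2 * real k + 1) * arcsine_moment (2 * k) / (2 * real k + 2)"
    by (simp add: field_simps)
  also have "\<dots> = pi * fact (2 * Suc k) / (4 ^ Suc k * (fact (Suc k))\<^sup>2)"
    unfolding Suc by (simp add: divide_simps) (simp add: algebra_simps power2_eq_square)
  finally show ?case .
qed

section \<open>The Bessel function as a Laplace transform\<close>

text \<open>Writing \<open>- 4 * u * t = - 2 * t + 2 * t * (1 - 2 * u)\<close>, the second
  exponential is expanded into its power series and integrated termwise against the density.\<close>

lemma bessel_I0_integral:
  "(LINT u|lborel. exp (- (4 * u * t)) * arcsine_density u) = pi * (exp (- 2 * t) * bessel_I0 (2 * t))"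
proof -
  define f where "f = (\<lambda>n u. (2 * t) ^ n / fact n * ((1 - 2 * u) ^ n * arcsine_density u))"
  have f_eq: "f n u = ((2 * t * (1 - 2 * u)) ^ n /\<^sub>R fact n) * arcsine_density u" for n u
    unfolding f_def power_mult_distrib[of "2 * t"] real_scaleR_def divide_inverse by (simp only: mult_ac)
  have f_sums: "(\<lambda>n. f n u) sums (exp (2 * t * (1 - 2 * u)) * arcsine_density u)" for u
    unfolding f_eq by (intro sums_mult2 exp_converges)
  have int: "integrable lborel (f n)" for n
    unfolding f_def by (intro integrable_mult_right integrable_arcsine_moment)
  have "(\<lambda>n. LINT u|lborel. f n u) sums (LINT u|lborel. (\<Sum>n. f n u))"
  proof (rule sums_integral[OF int])
    have "summable (\<lambda>n. norm (f n u))" for u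
      unfolding f_eq norm_mult by (intro summable_mult2 summable_norm_exp)
    thus "AE u in lborel. summable (\<lambda>n. norm (f n u))" by simp
    \<comment> \<open>On the support \<open>\<bar>1 - 2 * u\<bar> \<le> 1\<close>, so these
      integrals are dominated by \<open>pi\<close> times the terms of the exponential series at
      \<open>\<bar>2 * t\<bar>\<close>.\<close>
    show "summable (\<lambda>n. LINT u|lborel. norm (f n u))"
    proof (rule summable_comparison_test_ev)
      show "summable (\<lambda>n. norm ((2 * t) ^ n /\<^sub>R fact n) * pi)"
        by (intro summable_mult2 summable_norm_exp)
      have "(LINT u|lborel. norm (f n u)) \<le>
              (LINT u|lborel. norm ((2 * t) ^ n /\<^sub>R fact n) * arcsine_density u)" for n
      proof (rule integral_mono)
        show "integrable lborel (\<lambda>u. norm ((2 * t) ^ n /\<^sub>R fact n) * arcsine_density u)"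
          using has_bochner_integral_arcsine_density by (intro integrable_mult_right integrable.intros)
        fix u :: real
        have "\<bar>1 - 2 * u\<bar> ^ n * arcsine_density u \<le> 1 * arcsine_density u"
        proof (cases "0 < u \<and> u < 1")
          case True
          thus ?thesis by (intro mult_right_mono power_le_one) auto
        qed (auto simp: arcsine_density_def)
        hence "norm ((2 * t) ^ n /\<^sub>R fact n) * (\<bar>1 - 2 * u\<bar> ^ n * arcsine_density u) \<le>
                norm ((2 * t) ^ n /\<^sub>R fact n) * (1 * arcsine_density u)"
          by (rule mult_left_mono) simp
        thus "norm (f n u) \<le> norm ((2 * t) ^ n /\<^sub>R fact n) * arcsine_density u"
          by (simp add: f_def abs_mult power_abs field_simps)
      qed (use int in auto)
      thus "\<forall>\<^sub>F n in sequentially. norm (LINT u|lborel. norm (f n u)) \<le> norm ((2 * t) ^ n /\<^sub>R fact n) * pi"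
        using has_bochner_integral_arcsine_density by (simp add: has_bochner_integral_iff)
    qed
  qed
  also have "(\<lambda>n. LINT u|lborel. f n u) = (\<lambda>n. (2 * t) ^ n / fact n * arcsine_moment n)"
    by (simp add: f_def arcsine_moment_def)
  also have "(\<lambda>u. \<Sum>n. f n u) = (\<lambda>u. exp (2 * t * (1 - 2 * u)) * arcsine_density u)"
    using f_sums by (auto simp: sums_iff)
  finally have "(\<lambda>n. (2 * t) ^ n / fact n * arcsine_moment n) sums
                  (LINT u|lborel. exp (2 * t * (1 - 2 * u)) * arcsine_density u)" .
  hence "(\<lambda>k. (2 * t) ^ (2 * k) / fact (2 * k) * arcsine_moment (2 * k)) sums
           (LINT u|lborel. exp (2 * t * (1 - 2 * u)) * arcsine_density u)"
  \<comment> \<open>The odd moments vanish, so the sum may be restricted to even exponents.\<close>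
  proof (subst (asm) sums_mono_reindex[of "\<lambda>k. 2 * k", symmetric])
    fix n :: nat assume "n \<notin> range (\<lambda>k. 2 * k)"
    then obtain k where "n = Suc (2 * k)"
      by (metis oddE evenE Suc_eq_plus1 rangeI)
    thus "(2 * t) ^ n / fact n * arcsine_moment n = 0"
      by (simp add: arcsine_moment_odd)
  qed (auto simp: strict_mono_def)
  also have "(\<lambda>k. (2 * t) ^ (2 * k) / fact (2 * k) * arcsine_moment (2 * k)) =
             (\<lambda>k. pi * ((2 * t / 2) ^ (2 * k) / (fact k)\<^sup>2))"
    by (auto simp: arcsine_moment_even power_mult_distrib power_mult)
  finally have "pi * bessel_I0 (2 * t) = (LINT u|lborel. exp (2 * t * (1 - 2 * u)) * arcsine_density u)"
    unfolding bessel_I0_def by (subst suminf_mult [symmetric])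
      (auto simp: sums_iff summable_mult_D)
  also have "(\<lambda>u. exp (2 * t * (1 - 2 * u)) * arcsine_density u) =
             (\<lambda>u. exp (2 * t) * (exp (- (4 * u * t)) * arcsine_density u))"
    by (auto simp: algebra_simps simp flip: exp_add)
  also have "(LINT u|lborel. exp (2 * t) * (exp (- (4 * u * t)) * arcsine_density u)) =
               exp (2 * t) * (LINT u|lborel. exp (- (4 * u * t)) * arcsine_density u)"
    by (rule integral_mult_right_zero)
  finally have *: "pi * bessel_I0 (2 * t) =
                     exp (2 * t) * (LINT u|lborel. exp (- (4 * u * t)) * arcsine_density u)" .
  have "pi * (exp (- 2 * t) * bessel_I0 (2 * t)) = exp (- 2 * t) * (pi * bessel_I0 (2 * t))"
    by (rule mult.left_commute)
  also have "\<dots> = (exp (- 2 * t) * exp (2 * t)) *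
                    (LINT u|lborel. exp (- (4 * u * t)) * arcsine_density u)"
    unfolding * by (rule mult.assoc [symmetric])
  also have "exp (- 2 * t) * exp (2 * t) = 1"
    by (simp flip: exp_add)
  finally show ?thesis by simp
qed

section \<open>The Mellin transform on the strip\<close>

text \<open>Integrating over \<open>t\<close> first gives a Gamma integral, convergent for
  \<open>Re s > 0\<close>; what remains is a Beta integral with parameters \<open>1/2 - s\<close>
  and \<open>1/2\<close>, convergent for \<open>Re s < 1 / 2\<close>.\<close>

lemma mellin_bessel_I0:
  assumes s: "0 < Re s" "Re s < 1 / 2"
  shows "(LINT t|lborel. of_real (exp (- 2 * t) * bessel_I0 (2 * t)) * pos_powr (s - 1) t) =
           Gamma s * 4 powr (- s) * Gamma (1/2 - s) / (of_real (sqrt pi) * Gamma (1 - s))"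
proof -
  define f where "f = (\<lambda>t u. pos_powr (s - 1) t * of_real (exp (- (4 * u * t))) * of_real (arcsine_density u))"
  have [measurable]: "case_prod (\<lambda>u t. f t u) \<in> borel_measurable (lborel \<Otimes>\<^sub>M lborel)"
    unfolding f_def by measurable
  have scale: "pos_powr (- s) (4 * u) * of_real (arcsine_density u) =
         4 powr (- s) * (pos_powr ((1/2 - s) - 1) u * pos_powr (1/2 - 1) (1 - u))" for u
  proof -
    have "1/2 - s - 1 = - s + (1/2 - 1)"
      by simp
    hence "pos_powr ((1/2 - s) - 1) u = pos_powr (- s) u * pos_powr (1/2 - 1) u"
      by (simp only: pos_powr_add)
    moreover have "pos_powr (- s) 4 = 4 powr (- s)"
      by (simp add: pos_powr_def)
    ultimately show ?thesis
      using pos_powr_mult[of 4 "- s" u] by (simp only: of_real_arcsine_density mult_ac)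
  qed
  \<comment> \<open>The scaled Gamma integral needs \<open>4 * u > 0\<close>; for other
    \<open>u\<close> the density makes the integrand vanish.\<close>
  have zero: "f t u = 0" if "u \<le> 0" for t u
    using that by (simp add: f_def arcsine_density_def)
  have G: "(LINT t|lborel. f t u) = Gamma s * (pos_powr (- s) (4 * u) * of_real (arcsine_density u))"
    "(LINT t|lborel. norm (f t u)) = Gamma (Re s) * norm (pos_powr (- s) (4 * u) * complex_of_real (arcsine_density u))"
    "integrable lborel (\<lambda>t. f t u)" for u
  proof -
    show "(LINT t|lborel. f t u) = Gamma s * (pos_powr (- s) (4 * u) * of_real (arcsine_density u))"
      using has_bochner_integral_Gamma_scaled[of s "4 * u"] s zero[of u]
      by (cases "u > 0") (auto simp: has_bochner_integral_iff f_def pos_powr_def arcsine_density_def)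
    show "integrable lborel (\<lambda>t. f t u)"
      using has_bochner_integral_Gamma_scaled[of s "4 * u"] s zero[of u]
      by (cases "u > 0") (auto simp: has_bochner_integral_iff f_def arcsine_density_def)
    show "(LINT t|lborel. norm (f t u)) = Gamma (Re s) * norm (pos_powr (- s) (4 * u) * complex_of_real (arcsine_density u))"
      using has_bochner_integral_norm_Gamma_scaled[of s "4 * u"] s zero[of u]
      by (cases "u > 0") (auto simp: has_bochner_integral_iff f_def norm_mult arcsine_density_def)
  qed
  have B: "has_bochner_integral lborel (\<lambda>u. pos_powr (- s) (4 * u) * of_real (arcsine_density u))
             (4 powr (- s) * Beta (1/2 - s) (1/2))"
    unfolding scale using s by (intro has_bochner_integral_mult_right has_bochner_integral_Beta_complex) auto
  have "integrable (lborel \<Otimes>\<^sub>M lborel) (case_prod (\<lambda>u t. f t u))"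
  proof (rule lborel_pair.Fubini_integrable)
    show "integrable lborel (\<lambda>u. LINT t|lborel. norm (case (u, t) of (u, t) \<Rightarrow> f t u))"
      using B unfolding prod.case G by (intro integrable_mult_right integrable_norm integrable.intros)
  qed (use G in auto)
  hence "(LINT t|lborel. LINT u|lborel. f t u) = (LINT u|lborel. LINT t|lborel. f t u)"
    by (rule lborel_pair.Fubini_integral)
  also have "\<dots> = Gamma s * (4 powr (- s) * Beta (1/2 - s) (1/2))"
    using B unfolding G by (simp add: has_bochner_integral_iff)
  also have "(\<lambda>t. LINT u|lborel. f t u) =
             (\<lambda>t. of_real pi * (of_real (exp (- 2 * t) * bessel_I0 (2 * t)) * pos_powr (s - 1) t))"
  proof
    fix t
    have "(LINT u|lborel. f t u) = pos_powr (s - 1) t *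
            (LINT u|lborel. of_real (exp (- (4 * u * t)) * arcsine_density u))"
      unfolding f_def by (subst integral_mult_right_zero [symmetric]) (simp add: mult_ac)
    also have "(LINT u|lborel. complex_of_real (exp (- (4 * u * t)) * arcsine_density u)) =
                 of_real (LINT u|lborel. exp (- (4 * u * t)) * arcsine_density u)"
      by (rule integral_complex_of_real)
    finally show "(LINT u|lborel. f t u) =
        of_real pi * (of_real (exp (- 2 * t) * bessel_I0 (2 * t)) * pos_powr (s - 1) t)"
      by (simp add: bessel_I0_integral)
  qed
  finally have "of_real pi * (LINT t|lborel. of_real (exp (- 2 * t) * bessel_I0 (2 * t)) * pos_powr (s - 1) t)
       = Gamma s * (4 powr (- s) * Beta (1/2 - s) (1/2))"
    by simp
  \<comment> \<open>One factor \<open>sqrt pi\<close> cancels the \<open>Gamma (1/2)\<close> in the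
    Beta function; the other remains in the denominator.\<close>
  moreover have "complex_of_real pi = of_real (sqrt pi) * of_real (sqrt pi)"
    by (simp flip: of_real_mult)
  moreover have "1/2 - s + 1/2 = 1 - s"
    by simp
  moreover define I where
    "I = (LINT t|lborel. of_real (exp (- 2 * t) * bessel_I0 (2 * t)) * pos_powr (s - 1) t)"
  ultimately have "of_real (sqrt pi) * (of_real (sqrt pi) * I) =
      of_real (sqrt pi) * (Gamma s * 4 powr (- s) * Gamma (1/2 - s) / Gamma (1 - s))"
    by (simp only: Beta_def Gamma_one_half_complex mult_ac times_divide_eq_right)
  hence "of_real (sqrt pi) * I = Gamma s * 4 powr (- s) * Gamma (1/2 - s) / Gamma (1 - s)"
    by (rule mult_left_cancel[THEN iffD1, rotated]) simp
  hence "I = Gamma s * 4 powr (- s) * Gamma (1/2 - s) / Gamma (1 - s) / of_real (sqrt pi)"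
    by (subst nonzero_eq_divide_eq) (simp_all only: mult.commute, simp_all)
  thus ?thesis
    by (simp only: I_def divide_divide_eq_left mult.commute)
qed

section \<open>The meromorphic continuation and its uniqueness\<close>

text \<open>
  Of the two closed forms, this one has no removable singularities, and at its poles the junk value
  0 of \<^const>\<open>Gamma\<close> agrees with the convention of \<^const>\<open>nicely_meromorphic_on\<close>.
\<close>

definition zeta_Z_continuation :: "complex \<Rightarrow> complex" where
  "zeta_Z_continuation s = 4 powr (- s) / of_real (sqrt pi) * rGamma (1 - s) * Gamma (1/2 - s)"

lemma zeta_Z_continuation_nicely_meromorphic: "zeta_Z_continuation nicely_meromorphic_on UNIV"
  unfolding nicely_meromorphic_on_def
proof (intro conjI ballI)
  \<comment> \<open>With \<open>Gamma\<close> as the inverse of \<open>rGamma\<close>, the function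
    is a quotient of entire functions.\<close>
  have "(\<lambda>s. 4 powr (- s) / of_real (sqrt pi) * rGamma (1 - s) * inverse (rGamma (1/2 - s)))
          meromorphic_on UNIV"
    by (intro meromorphic_intros analytic_on_imp_meromorphic_on analytic_intros) auto
  thus "zeta_Z_continuation meromorphic_on UNIV"
    unfolding zeta_Z_continuation_def [abs_def] Gamma_def .
next
  fix z :: complex
  have coeff: "(\<lambda>s. 4 powr (- s) / of_real (sqrt pi) * rGamma (1 - s)) analytic_on {z}"
    by (intro analytic_intros) auto
  show "is_pole zeta_Z_continuation z \<and> zeta_Z_continuation z = 0 \<or>
        zeta_Z_continuation \<midarrow>z\<rightarrow> zeta_Z_continuation z"
  proof (cases "1/2 - z \<in> \<int>\<^sub>\<le>\<^sub>0")
    case False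
    hence "zeta_Z_continuation analytic_on {z}"
      unfolding zeta_Z_continuation_def [abs_def]
      by (intro analytic_on_mult[OF coeff] analytic_intros) auto
    thus ?thesis
      by (intro disjI2 isContD analytic_at_imp_isCont)
  next
    case True
    then obtain n where n: "1/2 - z = - of_nat n"
      by (auto elim!: nonpos_Ints_cases')
    \<comment> \<open>A parity argument: the poles of the Gamma factor are half-odd-integers, while
      \<open>rGamma (1 - s)\<close> vanishes only at positive integers. So no pole is
      cancelled.\<close>
    have "1 - z \<notin> \<int>\<^sub>\<le>\<^sub>0"
    proof
      assume "1 - z \<in> \<int>\<^sub>\<le>\<^sub>0"
      then obtain m where "1 - z = - of_nat m"
        by (auto elim!: nonpos_Ints_cases')
      hence "2 * (1 - z) = - (2 * of_nat m)" by simp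
      moreover have "2 * (1/2 - z) = - (2 * of_nat n)" unfolding n by simp
      ultimately have "1 + 2 * of_nat n = (2 + 2 * of_nat m :: complex)"
        by (simp add: algebra_simps)
      hence "complex_of_int (2 * int n + 1) = of_int (2 * int m + 2)"
        by (simp add: add_ac)
      hence "2 * int n + 1 = 2 * int m + 2"
        by (simp only: of_int_eq_iff)
      thus False by presburger
    qed
    hence "4 powr (- z) / of_real (sqrt pi) * rGamma (1 - z) \<noteq> 0"
      by (simp add: rGamma_eq_zero_iff)
    moreover have "is_pole (\<lambda>s. Gamma (1/2 - s)) z"
    proof (rule is_pole_compose[where w = "1/2 - z" and f = Gamma and g = "\<lambda>s. 1/2 - s"])
      show "is_pole (Gamma :: complex \<Rightarrow> complex) (1/2 - z)"
        unfolding n by (rule is_pole_Gamma)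
      show "(\<lambda>s. 1/2 - s) \<midarrow>z\<rightarrow> 1/2 - z"
        by (intro tendsto_intros)
      show "\<forall>\<^sub>F s in at z. 1/2 - s \<noteq> 1/2 - z"
        by (simp add: eventually_at_filter)
    qed
    ultimately have "is_pole zeta_Z_continuation z"
      unfolding zeta_Z_continuation_def [abs_def]
      by (intro is_pole_mult_analytic_nonzero1 coeff)
    moreover have "zeta_Z_continuation z = 0"
      using True by (simp add: zeta_Z_continuation_def Gamma_eq_zero_iff)
    ultimately show ?thesis by blast
  qed
qed

text \<open>The identity theorem makes \<open>f\<close> and \<open>g\<close> agree near each point
  apart from the point itself. Normalisation then fixes the value there: the common limit, or 0 at a
  common pole.\<close>

lemma nicely_meromorphic_on_eqI:
  assumes f: "f nicely_meromorphic_on B" and g: "g nicely_meromorphic_on B"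
    and AB: "open A" "A \<noteq> {}" "A \<subseteq> B" "open B" "connected B"
    and eq: "\<And>z. z \<in> A \<Longrightarrow> f z = g z"
    and z: "z \<in> B"
  shows "f z = g z"
proof -
  have mero: "f meromorphic_on B" "g meromorphic_on B"
    using f g by (auto simp: nicely_meromorphic_on_def)
  hence mero': "(\<lambda>z. f z - g z) meromorphic_on B"
    by (rule meromorphic_on_diff)
  \<comment> \<open>A difference of nicely meromorphic functions need not be one: where poles
    cancel, the value may differ from the limit.\<close>
  define h where "h = remove_sings (\<lambda>z. f z - g z)"
  obtain w where w: "w \<in> A" using AB by blast
  have h0: "h x = 0" if "x \<in> B" for x
  proof (rule frequently_eq_meromorphic_imp_constant[where f = h and c = 0 and z = w and A = B])
    have "\<forall>\<^sub>F x in at w. x \<in> A"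
      using AB w by (intro eventually_at_in_open') auto
    moreover have "\<forall>\<^sub>F x in at w. h x = f x - g x"
      unfolding h_def using AB w
      by (intro eventually_remove_sings_eq_at meromorphic_on_isolated_singularity meromorphic_on_subset[OF mero']) auto
    ultimately have "\<forall>\<^sub>F x in at w. h x = 0"
      by eventually_elim (simp add: eq)
    thus "\<exists>\<^sub>F x in at w. h x = 0"
      by (intro eventually_frequently) auto
    show "h nicely_meromorphic_on B"
      unfolding h_def by (intro remove_sings_nicely_meromorphic mero')
  qed (use AB w that in auto)
  have "\<forall>\<^sub>F x in at z. h x = f x - g x"
    unfolding h_def using z
    by (intro eventually_remove_sings_eq_at meromorphic_on_isolated_singularity meromorphic_on_subset[OF mero']) auto
  moreover have "\<forall>\<^sub>F x in at z. x \<in> B"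
    using AB z by (intro eventually_at_in_open') auto
  ultimately have ev: "\<forall>\<^sub>F x in at z. f x = g x"
    by eventually_elim (simp add: h0)
  hence pole: "is_pole f z \<longleftrightarrow> is_pole g z" and lim: "(f \<midarrow>z\<rightarrow> c) \<longleftrightarrow> (g \<midarrow>z\<rightarrow> c)" for c
    by (auto intro!: is_pole_cong tendsto_cong)
  show ?thesis
  proof (cases "is_pole f z")
    case True
    thus ?thesis
      using f g z pole unfolding nicely_meromorphic_on_def is_pole_def
      by (metis at_neq_bot not_tendsto_and_filterlim_at_infinity)
  next
    case False
    hence "f \<midarrow>z\<rightarrow> f z" "g \<midarrow>z\<rightarrow> g z"
      using f g z pole unfolding nicely_meromorphic_on_def by auto
    thus ?thesis
      using lim LIM_unique by blast
  qed
qed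

section \<open>The infinite product\<close>

text \<open>The numerators and denominators are Pochhammer symbols. The Gauss normalisations cancel
  because \<open>2 * (1 - s) = 1 + (1 - 2 * s)\<close>.\<close>

lemma prod_zeta_Z_factor:
  "(\<Prod>k\<le>n. zeta_Z_factor s (Suc k)) =
     (rGamma_series (1 - s) n)\<^sup>2 / (rGamma_series 1 n * rGamma_series (1 - 2 * s) n)"
proof -
  have P: "(\<Prod>k\<le>n. of_nat (Suc k) - w) = pochhammer (1 - w) (n + 1)" for w :: complex
    by (simp add: pochhammer_Suc_prod atMost_atLeast0 algebra_simps)
  have "(\<Prod>k\<le>n. zeta_Z_factor s (Suc k)) =
          (pochhammer (1 - s) (n + 1))\<^sup>2 / (pochhammer 1 (n + 1) * pochhammer (1 - 2 * s) (n + 1))"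
    using P[of 0] P[of s] P[of "2 * s"]
    by (simp only: zeta_Z_factor_def prod_dividef prod.distrib prod_power_distrib [symmetric] diff_zero)
  also have "\<dots> = (rGamma_series (1 - s) n)\<^sup>2 / (rGamma_series 1 n * rGamma_series (1 - 2 * s) n)"
  proof -
    define L where "L = complex_of_real (ln (real n))"
    have "(exp ((1 - s) * L))\<^sup>2 = exp (1 * L) * exp ((1 - 2 * s) * L)"
      by (simp add: power2_eq_square algebra_simps flip: exp_add)
    thus ?thesis
      unfolding rGamma_series_def L_def [symmetric] power_divide power_mult_distrib
      by (simp add: power2_eq_square)
  qed
  finally show ?thesis .
qed

text \<open>Legendre duplication at \<open>1/2 - s\<close>, whose power of 2 cancels
  \<open>4 powr (- s)\<close>. Odd values of \<open>2 * s\<close> would be poles of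
  \<open>Gamma (1/2 - s)\<close>, even ones zeros of \<open>rGamma (1 - s)\<close>.\<close>

lemma zeta_Z_continuation_conv_rGamma:
  assumes "\<nexists>n::nat. n \<ge> 1 \<and> 2 * s = of_nat n"
  shows "zeta_Z_continuation s = (rGamma (1 - s))\<^sup>2 / rGamma (1 - 2 * s)" "zeta_Z_continuation s \<noteq> 0"
proof -
  have *: "1/2 - s \<notin> \<int>\<^sub>\<le>\<^sub>0" "1 - s \<notin> \<int>\<^sub>\<le>\<^sub>0"
  proof -
    have False if "1/2 - s = - of_nat n" for n
    proof -
      from that have "s = 1/2 + of_nat n"
        by (simp add: algebra_simps)
      hence "2 * s = of_nat (2 * n + 1)" by simp
      with assms show False by (meson le_add2)
    qed
    thus "1/2 - s \<notin> \<int>\<^sub>\<le>\<^sub>0"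
      by (auto elim!: nonpos_Ints_cases')
    have False if "1 - s = - of_nat n" for n
    proof -
      from that have "s = 1 + of_nat n"
        by (simp add: algebra_simps)
      hence "2 * s = of_nat (2 * n + 2)" by simp
      with assms show False by (metis one_le_numeral trans_le_add2)
    qed
    thus "1 - s \<notin> \<int>\<^sub>\<le>\<^sub>0"
      by (auto elim!: nonpos_Ints_cases')
  qed
  show "zeta_Z_continuation s \<noteq> 0"
    using * by (simp add: zeta_Z_continuation_def rGamma_eq_zero_iff Gamma_eq_zero_iff)
  have "Gamma (1/2 - s) * Gamma (1 - s) =
          exp (2 * s * of_real (ln 2)) * of_real (sqrt pi) * Gamma (1 - 2 * s)"
    using Gamma_legendre_duplication[of "1/2 - s"] * by (simp add: algebra_simps)
  moreover have "4 powr (- s) * exp (2 * s * of_real (ln 2)) = 1"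
  proof -
    have "Ln 4 = complex_of_real (ln (2 ^ 2))"
      by (subst Ln_of_real [symmetric]) auto
    also have "ln (2 ^ 2 :: real) = 2 * ln 2"
      by (subst ln_realpow) auto
    finally have "4 powr (- s) = exp (- (2 * s * of_real (ln 2)))"
      by (simp add: powr_def mult_ac)
    thus ?thesis by (simp flip: exp_add)
  qed
  ultimately have "4 powr (- s) * (Gamma (1/2 - s) * Gamma (1 - s)) = of_real (sqrt pi) * Gamma (1 - 2 * s)"
    by (simp add: mult_ac)
  moreover have "Gamma (1 - s) \<noteq> 0"
    using * by (simp add: Gamma_eq_zero_iff)
  ultimately show "zeta_Z_continuation s = (rGamma (1 - s))\<^sup>2 / rGamma (1 - 2 * s)"
    by (simp add: zeta_Z_continuation_def rGamma_inverse_Gamma field_simps power2_eq_square)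
qed

lemma zeta_Z_factor_product:
  assumes s: "\<nexists>n::nat. n \<ge> 1 \<and> 2 * s = of_nat n"
  shows "convergent_prod (\<lambda>k. zeta_Z_factor s (Suc k))"
    and "(\<Prod>k. zeta_Z_factor s (Suc k)) = zeta_Z_continuation s"
proof -
  have "1 - 2 * s \<notin> \<int>\<^sub>\<le>\<^sub>0"
  proof
    assume "1 - 2 * s \<in> \<int>\<^sub>\<le>\<^sub>0"
    then obtain n where "1 - 2 * s = - of_nat n"
      by (auto elim!: nonpos_Ints_cases')
    hence "2 * s = of_nat (Suc n)"
      by (simp add: algebra_simps)
    with s show False by (metis One_nat_def Suc_le_mono le0)
  qed
  hence "(\<lambda>n. \<Prod>k\<le>n. zeta_Z_factor s (Suc k)) \<longlonglongrightarrow> (rGamma (1 - s))\<^sup>2 / (rGamma 1 * rGamma (1 - 2 * s))"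
    unfolding prod_zeta_Z_factor by (intro tendsto_intros) (simp_all add: rGamma_eq_zero_iff)
  hence lim: "(\<lambda>n. \<Prod>k\<le>n. zeta_Z_factor s (Suc k)) \<longlonglongrightarrow> zeta_Z_continuation s"
    using zeta_Z_continuation_conv_rGamma[OF s] by simp
  \<comment> \<open>Convergence of a product with nonzero factors means that the partial products
    have a nonzero limit. A zero in a numerator would make \<open>2 * s\<close> an even positive
    integer.\<close>
  have "zeta_Z_factor s (Suc k) \<noteq> 0" for k
  proof -
    have nz: "2 * s \<noteq> of_nat n" if "n \<ge> 1" for n
      using s that by blast
    have "of_nat (Suc k) - s \<noteq> 0"
    proof
      assume "of_nat (Suc k) - s = 0"
      hence "s = of_nat (Suc k)" by (metis eq_iff_diff_eq_0)
      hence "2 * s = of_nat (2 * Suc k)" by simp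
      with nz[of "2 * Suc k"] show False by simp
    qed
    moreover have "of_nat (Suc k) - 2 * s \<noteq> 0"
      using nz[of "Suc k"] by auto
    ultimately show ?thesis
      by (simp add: zeta_Z_factor_def del: of_nat_Suc)
  qed
  with lim zeta_Z_continuation_conv_rGamma(2)[OF s]
  show "convergent_prod (\<lambda>k. zeta_Z_factor s (Suc k))"
    by (subst convergent_prod_iff_nz_lim) auto
  show "(\<Prod>k. zeta_Z_factor s (Suc k)) = zeta_Z_continuation s"
    using prodinf_eq_prod_lim[OF lim] zeta_Z_continuation_conv_rGamma(2)[OF s] by simp
qed

section \<open>Identification with the spectral zeta function\<close>

lemma spectral_zeta_Z_integral_eq:
  assumes s: "0 < Re s" "Re s < 1 / 2"
  shows "spectral_zeta_Z_integral s = zeta_Z_continuation s"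
proof -
  have "(LBINT t:{0<..}. of_real (exp (- 2 * t) * bessel_I0 (2 * t)) *
           complex_of_real t powr s / complex_of_real t) =
        (LINT t|lborel. of_real (exp (- 2 * t) * bessel_I0 (2 * t)) * pos_powr (s - 1) t)"
    unfolding set_lebesgue_integral_def
    by (intro Bochner_Integration.integral_cong) (auto simp: pos_powr_def powr_diff indicator_def)
  also note mellin_bessel_I0[OF s]
  finally have "spectral_zeta_Z_integral s = 1 / Gamma s *
      (Gamma s * 4 powr (- s) * Gamma (1/2 - s) / (of_real (sqrt pi) * Gamma (1 - s)))"
    unfolding spectral_zeta_Z_integral_def by simp
  moreover have "Gamma s \<noteq> 0"
    using s nonpos_Ints_imp_Re_nonpos[of s] by (auto simp: Gamma_eq_zero_iff)
  ultimately show ?thesis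
    by (simp add: zeta_Z_continuation_def rGamma_inverse_Gamma field_simps)
qed

text \<open>Existence for the definite description comes from the explicit closed form, uniqueness
  from the identity theorem on the nonempty open strip.\<close>

lemma spectral_zeta_Z_eq: "spectral_zeta_Z = zeta_Z_continuation"
  unfolding spectral_zeta_Z_def
proof (rule the_equality)
  show "zeta_Z_continuation nicely_meromorphic_on UNIV \<and>
          (\<forall>s. 0 < Re s \<and> Re s < 1 / 2 \<longrightarrow> zeta_Z_continuation s = spectral_zeta_Z_integral s)"
    using zeta_Z_continuation_nicely_meromorphic spectral_zeta_Z_integral_eq by simp
next
  fix f
  assume f: "f nicely_meromorphic_on UNIV \<and>
               (\<forall>s. 0 < Re s \<and> Re s < 1 / 2 \<longrightarrow> f s = spectral_zeta_Z_integral s)"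
  define A where "A = {s. 0 < Re s} \<inter> {s. Re s < 1 / 2}"
  show "f = zeta_Z_continuation"
  proof
    fix z
    show "f z = zeta_Z_continuation z"
    proof (rule nicely_meromorphic_on_eqI[of f UNIV zeta_Z_continuation A])
      show "open A"
        unfolding A_def by (intro open_Int open_halfspace_Re_gt open_halfspace_Re_lt)
      have "of_real (1/4) \<in> A" by (simp add: A_def)
      thus "A \<noteq> {}" by blast
      show "f s = zeta_Z_continuation s" if "s \<in> A" for s
        using f that spectral_zeta_Z_integral_eq[of s] by (auto simp: A_def)
    qed (use f zeta_Z_continuation_nicely_meromorphic in auto)
  qed
qed

theorem theorem2:
  "(\<forall>s :: complex. (\<nexists>n::nat. n \<ge> 1 \<and> 2 * s = of_nat n) \<longrightarrow>
      convergent_prod (\<lambda>k. zeta_Z_factor s (Suc k)) \<and>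
      spectral_zeta_Z s = (\<Prod>k. zeta_Z_factor s (Suc k))) \<and>
   (\<forall>s0 :: complex. (\<exists>n::nat. n \<ge> 1 \<and> s0 = of_nat n / 2) \<longrightarrow>
      (if is_pole spectral_zeta_Z s0
       then filterlim (\<lambda>s. \<Prod>k. zeta_Z_factor s (Suc k)) at_infinity (at s0)
       else ((\<lambda>s. \<Prod>k. zeta_Z_factor s (Suc k)) \<longlongrightarrow> spectral_zeta_Z s0) (at s0)))"
proof (intro conjI allI impI)
  fix s :: complex assume "\<nexists>n::nat. n \<ge> 1 \<and> 2 * s = of_nat n"
  note product = zeta_Z_factor_product[OF this]
  show "convergent_prod (\<lambda>k. zeta_Z_factor s (Suc k))"
    by (fact product(1))
  show "spectral_zeta_Z s = (\<Prod>k. zeta_Z_factor s (Suc k))"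
    by (simp only: product(2) spectral_zeta_Z_eq)
next
  fix s0 :: complex assume "\<exists>n::nat. n \<ge> 1 \<and> s0 = of_nat n / 2"
  then obtain n :: nat where n: "s0 = of_nat n / 2" by blast
  \<comment> \<open>The exceptional points are spaced 1/2 apart, so this punctured ball contains
    none of them.\<close>
  have "\<forall>\<^sub>F s in at s0. s \<in> ball s0 (1/2) - {s0}"
    by (intro eventually_at_in_open) auto
  hence ev: "\<forall>\<^sub>F s in at s0. (\<Prod>k. zeta_Z_factor s (Suc k)) = spectral_zeta_Z s"
  proof eventually_elim
    case (elim s)
    have "2 * s \<noteq> of_nat m" for m
    proof
      assume m: "2 * s = of_nat m"
      \<comment> \<open>Doubling turns the radius into 1, and natural numbers at distance below 1
        coincide.\<close>
      have "dist (of_nat n :: complex) (of_nat m) = 2 * dist s0 s"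
        unfolding m [symmetric] n by (simp add: dist_norm field_simps flip: norm_mult_numeral1)
      hence "dist (of_nat n :: complex) (of_nat m) < 1"
        using elim by simp
      hence "n = m"
        by (simp add: dist_of_nat)
      hence "2 * s = 2 * s0"
        by (simp add: m n)
      with elim show False by simp
    qed
    thus ?case
      by (simp add: zeta_Z_factor_product spectral_zeta_Z_eq)
  qed
  show "if is_pole spectral_zeta_Z s0
        then filterlim (\<lambda>s. \<Prod>k. zeta_Z_factor s (Suc k)) at_infinity (at s0)
        else ((\<lambda>s. \<Prod>k. zeta_Z_factor s (Suc k)) \<longlongrightarrow> spectral_zeta_Z s0) (at s0)"
    \<comment> \<open>The product and the zeta function agree near \<open>s0\<close> off
      \<open>s0\<close>, hence share their limiting behaviour; away from poles, nice meromorphy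
      makes the limit the value.\<close>
    using zeta_Z_continuation_nicely_meromorphic ev
    by (auto simp: nicely_meromorphic_on_def is_pole_def filterlim_cong[OF refl refl ev] tendsto_cong[OF ev] spectral_zeta_Z_eq [symmetric])
qed

end
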